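(* Let $L>0$, let $f:\mathbb{R}^d\to\mathbb{R}$ be convex and $L$-smooth, and let $x^\star$ be a minimizer of $f$, with $f^\star=f(x^\star)$. Set $A_k=(1+k/12)^{4/3}$ for $k\ge0$. Independently sample $u_k\sim\operatorname{Unif}(A_k,A_{k+1})$ for every $k\ge0$. Put $$\delta_k=\frac12\Big(\frac1{u_k^2}-\frac1{u_{k+1}^2}\Big),\qquad \eta_k=\frac{(A_{k+1}-A_k)\,u_k^2\,\delta_k}{L}\quad(k\ge0),\qquad \beta_k=\frac{\delta_k}{\delta_{k-1}}\quad(k\ge1),\qquad\beta_0=0$$ (all $\delta_k$ are positive almost surely). Then, for any starting point $x^0\in\mathbb{R}^d$ and every deterministic $K\ge1$, the heavy-ball iterates $$x^{k+1}=x^k-\eta_k\nabla f(x^k)+\beta_k(x^k-x^{k-1}),\quad k\ge0,\qquad x^{-1}=x^0,$$ satisfy $$\mathbb{E}[f(x^K)-f^\star]\le\frac{84L\|x^0-x^\star\|^2}{K^{4/3}}.$$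
   Context: $\|\cdot\|$ is the Euclidean norm on $\mathbb{R}^d$. A function $f$ is $L$-smooth if it is differentiable and $\|\nabla f(x)-\nabla f(y)\|\le L\|x-y\|$ for all $x,y\in\mathbb{R}^d$. The starting point $x^0$ is deterministic and the gradient oracle is exact; the only randomness is in the sampled times $(u_k)_{k\ge0}$. *)

theory Defs
  imports "HOL-Probability.Probability"
begin

text \<open>By Riesz representation and uniqueness of derivatives the description below is proper at every
  point of differentiability, see the two lemmas following it.\<close>

definition gradient :: "(real ^ 'd \<Rightarrow> real) \<Rightarrow> real ^ 'd \<Rightarrow> real ^ 'd"
  where "gradient f x = (THE g. GDERIV f x :> g)"

lemma gradient_eqI:
  fixes f :: "real ^ 'd \<Rightarrow> real"
  assumes "GDERIV f x :> g"
  shows "gradient f x = g"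
  unfolding gradient_def
proof (rule the_equality)
  show "GDERIV f x :> g" by (fact assms)
next
  fix g' assume "GDERIV f x :> g'"
  with assms have "(\<lambda>h. inner h g') = (\<lambda>h. inner h g)"
    unfolding gderiv_def by (intro has_derivative_unique)
  then show "g' = g"
    by (metis vector_eq_ldot)
qed

lemma GDERIV_gradient:
  fixes f :: "real ^ 'd \<Rightarrow> real"
  assumes "f differentiable (at x)"
  shows "GDERIV f x :> gradient f x"
proof -
  obtain D where D: "(f has_derivative D) (at x)"
    using assms by (auto simp: differentiable_def)
  interpret linear D
    using D by (rule has_derivative_linear)
  have "D h = inner h (adjoint D 1)" for h
    using adjoint_works[OF linear_axioms, of h 1] by simp
  then have "GDERIV f x :> adjoint D 1"
    using D unfolding gderiv_def by (metis ext)
  then show ?thesis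
    using gradient_eqI by metis
qed

definition smooth_with :: "real \<Rightarrow> (real ^ 'd \<Rightarrow> real) \<Rightarrow> bool"
  where "smooth_with L f \<longleftrightarrow>
    (\<forall>x. f differentiable (at x)) \<and>
    (\<forall>x y. norm (gradient f x - gradient f y) \<le> L * norm (x - y))"

definition A :: "nat \<Rightarrow> real"
  where "A k = (1 + real k / 12) powr (4 / 3)"

text \<open>In what follows \<open>u\<close> is one realisation of the sampled times.\<close>

definition delta :: "(nat \<Rightarrow> real) \<Rightarrow> nat \<Rightarrow> real"
  where "delta u k = 1 / 2 * (1 / (u k)\<^sup>2 - 1 / (u (Suc k))\<^sup>2)"

definition eta :: "real \<Rightarrow> (nat \<Rightarrow> real) \<Rightarrow> nat \<Rightarrow> real"
  where "eta L u k = (A (Suc k) - A k) * (u k)\<^sup>2 * delta u k / L"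

definition beta :: "(nat \<Rightarrow> real) \<Rightarrow> nat \<Rightarrow> real"
  where "beta u k = (if k = 0 then 0 else delta u k / delta u (k - 1))"

text \<open>For \<open>k = 0\<close> the truncated \<open>k - 1\<close> is \<open>0\<close>, which encodes the convention that the iterate with
  index \<open>-1\<close> is the starting point.\<close>

fun heavy_ball ::
    "real \<Rightarrow> (real ^ 'd \<Rightarrow> real) \<Rightarrow> (nat \<Rightarrow> real) \<Rightarrow> real ^ 'd \<Rightarrow> nat \<Rightarrow> real ^ 'd"
  where
    "heavy_ball L f u x0 0 = x0"
  | "heavy_ball L f u x0 (Suc k) =
       heavy_ball L f u x0 k
       - eta L u k *\<^sub>R gradient f (heavy_ball L f u x0 k)
       + beta u k *\<^sub>R (heavy_ball L f u x0 k - heavy_ball L f u x0 (k - 1))"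

end

theory Submission
  imports Defs
begin

text \<open>
  Scale \<open>f\<close> to \<open>F = (f - f\<^sup>\<star>) / L\<close> with gradient \<open>g\<close>, and let a pair \<open>(x, z)\<close> evolve in continuous time:
  between the times \<open>u\<^sub>k\<close> the point \<open>z\<close> stays fixed and \<open>x' = 2 (z - x) / t\<close>; at time \<open>u\<^sub>k\<close> the point \<open>z\<close>
  jumps by \<open>- (A\<^sub>k\<^sub>+\<^sub>1 - A\<^sub>k) g(x) / 2\<close>. The positions \<open>x(u\<^sub>k)\<close> are the heavy-ball iterates. As \<open>u\<^sub>k\<close> is uniform, the
  expected effect of a jump is an integral over the interval, so that up to discretisation errors
  the pair follows \<open>x' = 2 (z - x) / t\<close>, \<open>z' = - g(x) / 2\<close>, for which
  \<open>t F(x) + 3/2 |z - x\<^sup>\<star>|\<^sup>2 + 1/2 |z - x|\<^sup>2\<close> decreases with a dissipation of order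
  \<open>|g(x)|\<^sup>2 + |z - x|\<^sup>2 / t\<close>. The leading error, of order \<open>(A\<^sub>k\<^sub>+\<^sub>1 - A\<^sub>k)\<^sup>2 |g|\<^sup>2\<close>, is cancelled on average by the
  displacement of \<open>x\<close> along \<open>- g\<close> between the jump and the end of the interval. The rest is absorbed by the
  dissipation as long as \<open>A\<^sub>k\<^sub>+\<^sub>1 - A\<^sub>k\<close> is at most a small multiple of \<open>A\<^sub>k\<close> to the power \<open>1/4\<close>,
  which is what the exponent \<open>4/3\<close> provides.
\<close>

section \<open>Smooth convex functions\<close>

lemma GDERIV_curve:
  fixes F :: "'a::real_inner \<Rightarrow> real"
  assumes "GDERIV F (c t) :> G" and "(c has_vector_derivative c') (at t within S)"
  shows "((\<lambda>s. F (c s)) has_real_derivative (c' \<bullet> G)) (at t within S)"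
proof -
  have "(F has_derivative (\<lambda>h. h \<bullet> G)) (at (c t) within c ` S)"
    using assms(1) unfolding gderiv_def by (rule has_derivative_at_withinI)
  then have "(F \<circ> c has_derivative (\<lambda>h. h \<bullet> G) \<circ> (\<lambda>h. h *\<^sub>R c')) (at t within S)"
    using assms(2) unfolding has_vector_derivative_def by (intro diff_chain_within)
  then show ?thesis
    by (simp add: has_field_derivative_def o_def mult.commute[of _ "c' \<bullet> G"])
qed

text \<open>Normalised setting: Lipschitz constant 1 and minimum 0, attained at \<open>xs\<close>.
  Dividing \<open>f\<close> and its gradient by \<open>L\<close> leads here.\<close>

locale smooth_convex =
  fixes F :: "'a::euclidean_space \<Rightarrow> real" and g :: "'a \<Rightarrow> 'a" and xs :: 'a
  assumes GDERIV: "\<And>x. GDERIV F x :> g x"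
    and convex: "convex_on UNIV F"
    and lipschitz: "\<And>x y. norm (g x - g y) \<le> norm (x - y)"
    and F_min: "F xs = 0"
    and F_nonneg: "\<And>x. F x \<ge> 0"
begin

lemma line_DERIV:
  "((\<lambda>s. F (x + s *\<^sub>R d)) has_real_derivative (d \<bullet> g (x + s *\<^sub>R d))) (at s within S)"
  by (rule GDERIV_curve[OF GDERIV]) (auto intro!: derivative_eq_intros)

text \<open>After the fraction \<open>s\<close> of the segment the gradient deviates from
  \<open>g x\<close> by at most \<open>s * norm (y - x)\<close>. Subtracting the linear part and the
  quadratic with this growth leaves a nonincreasing function.\<close>

lemma descent: "F y \<le> F x + g x \<bullet> (y - x) + (norm (y - x))\<^sup>2 / 2"
proof -
  let ?d = "y - x"
  let ?h = "\<lambda>s. F (x + s *\<^sub>R ?d) - s * (g x \<bullet> ?d) - s\<^sup>2 * (norm ?d)\<^sup>2 / 2"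
  have "?h 1 \<le> ?h 0"
  proof (rule DERIV_nonpos_imp_nonincreasing[of 0 1 ?h])
    fix s :: real assume s: "0 \<le> s" "s \<le> 1"
    have D: "(?h has_real_derivative (?d \<bullet> g (x + s *\<^sub>R ?d) - g x \<bullet> ?d - s * (norm ?d)\<^sup>2)) (at s)"
      by (auto intro!: derivative_eq_intros line_DERIV)
    have "?d \<bullet> g (x + s *\<^sub>R ?d) - g x \<bullet> ?d = (g (x + s *\<^sub>R ?d) - g x) \<bullet> ?d"
      by (simp add: inner_diff_left inner_diff_right inner_commute)
    also have "\<dots> \<le> norm (g (x + s *\<^sub>R ?d) - g x) * norm ?d"
      by (rule norm_cauchy_schwarz)
    also have "\<dots> \<le> norm (s *\<^sub>R ?d) * norm ?d"
      using lipschitz[of "x + s *\<^sub>R ?d" x] by (intro mult_right_mono) auto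
    also have "\<dots> = s * (norm ?d)\<^sup>2"
      using s by (simp add: power2_eq_square)
    finally show "\<exists>y. (?h has_real_derivative y) (at s) \<and> y \<le> 0"
      using D by (intro exI[of _ "?d \<bullet> g (x + s *\<^sub>R ?d) - g x \<bullet> ?d - s * (norm ?d)\<^sup>2"]) auto
  qed auto
  then show ?thesis by simp
qed

text \<open>A unit gradient step lowers \<open>F\<close> by at least half the squared gradient norm,
  and \<open>F\<close> cannot become negative.\<close>

lemma norm_gradient_le: "(norm (g x))\<^sup>2 \<le> 2 * F x"
proof -
  have "0 \<le> F (x - g x)" by (rule F_nonneg)
  also have "\<dots> \<le> F x - (norm (g x))\<^sup>2 / 2"
    using descent[of "x - g x" x] by (simp add: power2_norm_eq_inner)
  finally show ?thesis by simp
qed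

text \<open>\<open>xs\<close> is critical by the preceding bound, so the linear term vanishes there.
  This serves to bound the initial energy.\<close>

lemma F_le: "F x \<le> (norm (x - xs))\<^sup>2 / 2"
proof -
  have "g xs = 0" using norm_gradient_le[of xs] F_min by simp
  then show ?thesis using descent[of x xs] F_min by simp
qed

text \<open>On the line through \<open>x\<close> and \<open>xs\<close>, the tangent at
  \<open>x\<close> lies below \<open>F\<close>; it is evaluated at \<open>xs\<close>, where
  \<open>F\<close> is 0.\<close>

lemma tangent: "F x \<le> g x \<bullet> (x - xs)"
proof -
  let ?d = "xs - x"
  have "convex_on UNIV (\<lambda>s::real. F (x + s *\<^sub>R ?d))"
  proof (rule convex_onI)
    fix t s1 s2 :: real assume "0 < t" "t < 1"
    have "x + ((1 - t) *\<^sub>R s1 + t *\<^sub>R s2) *\<^sub>R ?d = (1 - t) *\<^sub>R (x + s1 *\<^sub>R ?d) + t *\<^sub>R (x + s2 *\<^sub>R ?d)"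
      by (simp add: algebra_simps)
    then show "F (x + ((1 - t) *\<^sub>R s1 + t *\<^sub>R s2) *\<^sub>R ?d)
        \<le> (1 - t) * F (x + s1 *\<^sub>R ?d) + t * F (x + s2 *\<^sub>R ?d)"
      using convex_onD[OF convex, of t] \<open>0 < t\<close> \<open>t < 1\<close> by simp
  qed simp
  then have "F (x + 1 *\<^sub>R ?d) - F (x + 0 *\<^sub>R ?d) \<ge> (?d \<bullet> g (x + 0 *\<^sub>R ?d)) * (1 - 0)"
    by (rule convex_on_imp_above_tangent) (use line_DERIV[of x ?d 0 UNIV] in auto)
  then show ?thesis using F_min by (simp add: inner_diff_left inner_diff_right inner_commute)
qed

end

section \<open>Decay of the energy\<close>

text \<open>Solution at time \<open>t\<close> of \<open>x' = 2 (z - x) / t\<close> with value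
  \<open>y\<close> at time \<open>s\<close>: the difference \<open>z - x\<close> decays like
  \<open>1 / t^2\<close>.\<close>

definition flow :: "real \<Rightarrow> real \<Rightarrow> 'a::real_vector \<Rightarrow> 'a \<Rightarrow> 'a"
  where "flow s t y z = z - (s\<^sup>2 / t\<^sup>2) *\<^sub>R (z - y)"

context smooth_convex begin

text \<open>\<open>y\<close> is the position at the left endpoint \<open>a\<close>, so the gradient
  is taken after flowing from \<open>a\<close> to \<open>t\<close>.\<close>

definition jump :: "real \<Rightarrow> real \<Rightarrow> real \<Rightarrow> 'a \<Rightarrow> 'a \<Rightarrow> 'a"
  where "jump a b t y z = z - ((b - a) / 2) *\<^sub>R g (flow a t y z)"

definition step :: "real \<Rightarrow> real \<Rightarrow> real \<Rightarrow> 'a \<times> 'a \<Rightarrow> 'a \<times> 'a"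
  where "step a b t = (\<lambda>(y, z). (flow t b (flow a t y z) (jump a b t y z), jump a b t y z))"

definition energy :: "real \<Rightarrow> 'a \<times> 'a \<Rightarrow> real"
  where "energy t = (\<lambda>(y, z). t * F y + 3 / 2 * (norm (z - xs))\<^sup>2 + 1 / 2 * (norm (z - y))\<^sup>2)"

lemma energy_nonneg: "t \<ge> 0 \<Longrightarrow> energy t p \<ge> 0"
  by (auto simp: energy_def F_nonneg split: prod.split)

text \<open>The flow moves \<open>y\<close> towards \<open>z\<close> by the fraction
  \<open>1 - a^2 / t^2\<close>. With the Lipschitz bound this limits the variation of the gradient
  within one interval.\<close>

lemma norm_flow_diff:
  assumes "0 < a" "a \<le> t" "t \<le> b"
  shows "norm (flow a t y z - y) \<le> 2 * (b - a) / a * norm (z - y)"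
proof -
  have "norm (flow a t y z - y) = \<bar>1 - a\<^sup>2 / t\<^sup>2\<bar> * norm (z - y)"
    unfolding norm_scaleR[symmetric] by (simp add: flow_def algebra_simps)
  moreover have "\<bar>1 - a\<^sup>2 / t\<^sup>2\<bar> \<le> 2 * (b - a) / a"
  proof -
    have "\<bar>1 - a\<^sup>2 / t\<^sup>2\<bar> = 1 - a\<^sup>2 / t\<^sup>2" using assms by (simp add: power_mono)
    \<comment> \<open>With \<open>v = a / t\<close> this is
      \<open>1 - v^2 <= 2 (1 - v)\<close>.\<close>
    also have "\<dots> \<le> 2 * (1 - a / t)"
      using zero_le_power2[of "1 - a / t"] by (simp add: power_divide power2_eq_square algebra_simps)
    also have "1 - a / t \<le> (b - a) / a"
    proof -
      have "1 - a / t = (t - a) / t" using assms by (simp add: field_simps)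
      also have "\<dots> \<le> (b - a) / a" using assms by (intro frac_le) auto
      finally show ?thesis .
    qed
    finally show ?thesis by simp
  qed
  ultimately show ?thesis
    by (simp only: mult_right_mono norm_ge_zero)
qed

end

text \<open>In the application \<open>r ^ 4\<close> and \<open>h\<close> are the left endpoint and the length of the interval, \<open>W\<close> is \<open>|z - x|\<close>,
  \<open>G\<close> and \<open>\<gamma>\<close> are the gradient norms at the left endpoint and at the jump, and \<open>\<delta>\<close> bounds the variation of
  the gradient along the flow. The right-hand side is the dissipation.\<close>

lemma error_budget:
  fixes h r W G \<gamma> \<delta> :: real
  assumes r: "r \<ge> 1" and h: "0 \<le> h" "8 * h \<le> r"
    and nonneg: "W \<ge> 0" "G \<ge> 0" "\<gamma> \<ge> 0"
    and \<delta>: "\<delta> = 2 * h / r ^ 4 * W" and G: "G \<le> \<gamma> + \<delta>"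
  shows "h ^ 3 / (2 * r ^ 4) * G\<^sup>2 + 3 / 2 * h\<^sup>2 * (2 * G * \<delta> + \<delta>\<^sup>2) + h ^ 4 / (2 * r ^ 4) * \<gamma>\<^sup>2
    + 2 * h\<^sup>2 / r ^ 4 * (\<gamma> * W) \<le> h * \<gamma>\<^sup>2 / 4 + h / r ^ 4 * W\<^sup>2"
proof -
  \<comment> \<open>In these units each term is \<open>h\<close> times a quadratic monomial in the
    gradient norms and \<open>\<omega>\<close>, with powers of \<open>k <= 1/8\<close> and of
    \<open>1 / r <= 1\<close> as coefficients.\<close>
  define k where "k = h / r"
  define \<omega> where "\<omega> = W / r\<^sup>2"
  have hk: "h = k * r" and W: "W = \<omega> * r\<^sup>2" using r by (simp_all add: k_def \<omega>_def)
  have k: "0 \<le> k" "k \<le> 1 / 8" using r h by (simp_all add: k_def field_simps)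
  have \<omega>: "\<omega> \<ge> 0" using nonneg by (simp add: \<omega>_def)
  have k2: "k\<^sup>2 \<le> 1 / 64" using power_mono[OF k(2,1), of 2] by (simp add: power2_eq_square)
  have k3: "k ^ 3 \<le> 1 / 512" using power_mono[OF k(2,1), of 3] by (simp add: power3_eq_cube)
  have div_le: "x / r ^ n \<le> c" if "0 \<le> x" "x \<le> c" for x c :: real and n
    by (rule order_trans[OF _ that(2)]) (use that(1) r in \<open>simp add: divide_le_eq mult_le_cancel_left1 one_le_power\<close>)
  have \<delta>': "\<delta> = 2 * k * \<omega> / r"
    unfolding \<delta> hk W using r by (simp add: field_simps power2_eq_square power4_eq_xxxx)
  also have "\<dots> \<le> \<omega> / 4"
    using div_le[of "2 * k * \<omega>" "\<omega> / 4" 1] k \<omega> mult_right_mono[OF k(2) \<omega>] by simp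
  finally have G': "G \<le> \<gamma> + \<omega> / 4" using G by simp
  \<comment> \<open>The five terms on the left, each divided by \<open>h\<close>, are bounded in
    order; the one with \<open>\<delta>\<close> is split into items 2 and 3.\<close>
  have 1: "h\<^sup>2 / (2 * r ^ 4) * G\<^sup>2 \<le> 1 / 128 * G\<^sup>2"
  proof (rule mult_right_mono)
    have "h\<^sup>2 / (2 * r ^ 4) = k\<^sup>2 / 2 / r ^ 2"
      unfolding hk using r by (simp add: field_simps power2_eq_square power4_eq_xxxx)
    then show "h\<^sup>2 / (2 * r ^ 4) \<le> 1 / 128" using div_le[of "k\<^sup>2 / 2" "1 / 128" 2] k2 by simp
  qed simp
  have 2: "3 * h * (G * \<delta>) \<le> 3 / 32 * (G * \<omega>)"
  proof -
    have "3 * h * (G * \<delta>) = 6 * k\<^sup>2 * (G * \<omega>)"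
      unfolding \<delta>' hk using r by (simp add: field_simps power2_eq_square)
    also have "\<dots> \<le> 3 / 32 * (G * \<omega>)"
      using k2 nonneg \<omega> by (intro mult_right_mono) auto
    finally show ?thesis .
  qed
  have 3: "3 / 2 * h * \<delta>\<^sup>2 \<le> 3 / 256 * \<omega>\<^sup>2"
  proof -
    have "3 / 2 * h * \<delta>\<^sup>2 = 6 * k ^ 3 / r ^ 1 * \<omega>\<^sup>2"
      unfolding \<delta>' hk using r by (simp add: field_simps power2_eq_square power3_eq_cube)
    also have "\<dots> \<le> 3 / 256 * \<omega>\<^sup>2"
      by (intro mult_right_mono div_le) (use k k3 in auto)
    finally show ?thesis .
  qed
  have 4: "h ^ 3 / (2 * r ^ 4) * \<gamma>\<^sup>2 \<le> 1 / 1024 * \<gamma>\<^sup>2"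
  proof (rule mult_right_mono)
    have "h ^ 3 / (2 * r ^ 4) = k ^ 3 / 2 / r ^ 1"
      unfolding hk using r by (simp add: field_simps power3_eq_cube power4_eq_xxxx)
    then show "h ^ 3 / (2 * r ^ 4) \<le> 1 / 1024" using div_le[of "k ^ 3 / 2" "1 / 1024" 1] k k3 by simp
  qed simp
  have 5: "2 * h / r ^ 4 * (\<gamma> * W) \<le> 1 / 4 * (\<gamma> * \<omega>)"
  proof -
    have "2 * h / r ^ 4 * (\<gamma> * W) = 2 * k / r ^ 1 * (\<gamma> * \<omega>)"
      unfolding W hk using r by (simp add: field_simps power2_eq_square power4_eq_xxxx)
    also have "\<dots> \<le> 1 / 4 * (\<gamma> * \<omega>)"
      by (intro mult_right_mono div_le) (use k nonneg \<omega> in auto)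
    finally show ?thesis .
  qed
  have 6: "W\<^sup>2 / r ^ 4 = \<omega>\<^sup>2"
    unfolding W using r by (simp add: field_simps power2_eq_square power4_eq_xxxx)
  have "1 / 128 * G\<^sup>2 + 3 / 32 * (G * \<omega>) \<le> 1 / 128 * (\<gamma> + \<omega> / 4)\<^sup>2 + 3 / 32 * ((\<gamma> + \<omega> / 4) * \<omega>)"
    using G' nonneg \<omega> by (intro add_mono mult_left_mono mult_right_mono power_mono) auto
  moreover have "1 / 128 * (\<gamma> + \<omega> / 4)\<^sup>2 + 3 / 32 * ((\<gamma> + \<omega> / 4) * \<omega>) + 3 / 256 * \<omega>\<^sup>2 + 1 / 1024 * \<gamma>\<^sup>2
      + 1 / 4 * (\<gamma> * \<omega>) \<le> \<gamma>\<^sup>2 / 4 + \<omega>\<^sup>2"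
  proof -
    have "(\<gamma> + \<omega> / 4)\<^sup>2 = \<gamma>\<^sup>2 + \<gamma> * \<omega> / 2 + \<omega>\<^sup>2 / 16"
      "(\<gamma> + \<omega> / 4) * \<omega> = \<gamma> * \<omega> + \<omega>\<^sup>2 / 4"
      by (simp_all add: power2_eq_square algebra_simps)
    moreover have "4 * (\<gamma> * \<omega>) \<le> \<gamma>\<^sup>2 + 4 * \<omega>\<^sup>2"
      using zero_le_power2[of "\<gamma> - 2 * \<omega>"] by (simp add: power2_eq_square algebra_simps)
    ultimately show ?thesis
      using zero_le_power2[of \<gamma>] zero_le_power2[of \<omega>] by linarith
  qed
  ultimately have "h\<^sup>2 / (2 * r ^ 4) * G\<^sup>2 + 3 * h * (G * \<delta>) + 3 / 2 * h * \<delta>\<^sup>2 + h ^ 3 / (2 * r ^ 4) * \<gamma>\<^sup>2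
      + 2 * h / r ^ 4 * (\<gamma> * W) \<le> \<gamma>\<^sup>2 / 4 + W\<^sup>2 / r ^ 4"
    using 1 2 3 4 5 6 by linarith
  \<comment> \<open>The common factor \<open>h\<close> is restored; it may be 0.\<close>
  then have "h * (h\<^sup>2 / (2 * r ^ 4) * G\<^sup>2 + 3 * h * (G * \<delta>) + 3 / 2 * h * \<delta>\<^sup>2 + h ^ 3 / (2 * r ^ 4) * \<gamma>\<^sup>2
      + 2 * h / r ^ 4 * (\<gamma> * W)) \<le> h * (\<gamma>\<^sup>2 / 4 + W\<^sup>2 / r ^ 4)"
    using h by (intro mult_left_mono)
  then show ?thesis
    by (simp add: algebra_simps add_divide_distrib power2_eq_square power3_eq_cube power4_eq_xxxx)
qed

context smooth_convex begin

text \<open>Averaged over \<open>t\<close>, the difference \<open>b F (x b) - a F y\<close> cancels the term after it, which is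
  \<open>b - a\<close> times the derivative of \<open>t F (x t)\<close>, and the last summand vanishes.\<close>

lemma energy_step:
  fixes r a b t :: real and y z :: 'a
  assumes r: "r \<ge> 1" "a = r ^ 4" and ab: "8 * (b - a) \<le> r" and t: "a \<le> t" "t \<le> b"
  defines "w \<equiv> z - y" and "x \<equiv> \<lambda>s. flow a s y z"
  shows "energy b (step a b t (y, z)) \<le> energy a (y, z) + (b * F (x b) - a * F y)
    - (b - a) * (F (x t) + 2 * (a\<^sup>2 / t\<^sup>2) * (w \<bullet> g (x t)))
    + (norm (g y))\<^sup>2 * ((b - a)\<^sup>2 / 2 - (b - a) * (b - t))"
proof -
  define h where "h = b - a"
  \<comment> \<open>\<open>p\<close> and \<open>q\<close> are the factors by which the flow
    contracts \<open>z - x\<close> from \<open>a\<close> to \<open>t\<close> and from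
    \<open>t\<close> to \<open>b\<close>.\<close>
  define p where "p = a\<^sup>2 / t\<^sup>2"
  define q where "q = t\<^sup>2 / b\<^sup>2"
  define \<gamma> where "\<gamma> = norm (g (x t))"
  define G where "G = norm (g y)"
  define W where "W = norm w"
  define \<delta> where "\<delta> = 2 * h / a * W"
  \<comment> \<open>The flow from \<open>t\<close> to \<open>b\<close> passes the fraction
    \<open>1 - q\<close> of the jump on to the position, which thus ends at distance
    \<open>s\<close> times the gradient from the undisturbed \<open>x b\<close>.\<close>
  define s where "s = (1 - q) * h / 2"
  define z' where "z' = jump a b t y z"
  have a1: "a \<ge> 1" using r by (simp add: one_le_power)
  have pos: "0 < a" "0 < t" "0 < b" using a1 t by auto
  have h: "0 \<le> h" using t by (simp add: h_def)
  have ha: "h \<le> a / 8"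
    using ab r power_increasing[of 1 4 r] by (simp add: h_def)
  have p: "0 \<le> p" "p \<le> 1" using pos t by (simp_all add: p_def power_mono)
  have q: "0 \<le> q" "q \<le> 1" using pos t by (simp_all add: q_def power_mono)
  have pq: "p * q = a\<^sup>2 / b\<^sup>2" using pos by (simp add: p_def q_def)
  have z': "z' = z - (h / 2) *\<^sub>R g (x t)" by (simp add: z'_def jump_def h_def x_def)
  have xt: "x t = z - p *\<^sub>R w" by (simp add: x_def flow_def p_def w_def)
  have xb: "x b = z - (p * q) *\<^sub>R w" by (simp add: x_def flow_def pq w_def)
  define y' where "y' = flow t b (x t) z'"
  have y': "y' = x b - s *\<^sub>R g (x t)"
  proof -
    define gx where "gx = g (x t)"
    have z'_gx: "z' = z - (h / 2) *\<^sub>R gx" by (simp add: z' gx_def)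
    have "y' = x b - s *\<^sub>R gx"
      unfolding y'_def flow_def q_def[symmetric] xb xt s_def z'_gx
      by (simp add: algebra_simps diff_divide_distrib)
    then show ?thesis by (simp add: gx_def)
  qed
  have w': "z' - y' = (p * q) *\<^sub>R w - (q * h / 2) *\<^sub>R g (x t)"
    unfolding y' z' xb s_def by (simp add: algebra_simps diff_divide_distrib)

  define I where "I = w \<bullet> g (x t)"
  define P where "P = g (x b) \<bullet> g (x t)"
  have \<delta>_0: "\<delta> \<ge> 0" using h pos by (simp add: \<delta>_def W_def)
  have gt: "norm (g (x t) - g y) \<le> \<delta>"
    using lipschitz[of "x t" y] norm_flow_diff[OF pos(1) t, of y z] by (simp add: x_def \<delta>_def W_def w_def h_def)
  have gb: "norm (g (x b) - g y) \<le> \<delta>"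
    using lipschitz[of "x b" y] norm_flow_diff[OF pos(1) _ order_refl, of b y z] t
    by (simp add: x_def \<delta>_def W_def w_def h_def)
  have G\<gamma>: "G \<le> \<gamma> + \<delta>" "\<gamma> \<le> G + \<delta>"
    using gt norm_triangle_ineq2[of "g y" "g (x t)"] norm_triangle_ineq2[of "g (x t)" "g y"]
    by (simp_all add: G_def \<gamma>_def norm_minus_commute)
  have nn: "G \<ge> 0" "\<gamma> \<ge> 0" "W \<ge> 0" by (simp_all add: G_def \<gamma>_def W_def)
  \<comment> \<open>Both gradients lie within \<open>\<delta>\<close> of \<open>g y\<close>, about
    which the product is expanded.\<close>
  have P: "P \<ge> G\<^sup>2 - (2 * G * \<delta> + \<delta>\<^sup>2)"
  proof -
    have "P = G\<^sup>2 + g y \<bullet> (g (x t) - g y) + (g (x b) - g y) \<bullet> g y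
        + (g (x b) - g y) \<bullet> (g (x t) - g y)"
      by (simp add: P_def G_def power2_norm_eq_inner inner_diff_left inner_diff_right)
    moreover have "\<bar>g y \<bullet> (g (x t) - g y)\<bar> \<le> G * \<delta>"
      using gt by (intro order_trans[OF Cauchy_Schwarz_ineq2]) (simp add: G_def mult_left_mono)
    moreover have "\<bar>(g (x b) - g y) \<bullet> g y\<bar> \<le> G * \<delta>"
      using gb by (intro order_trans[OF Cauchy_Schwarz_ineq2]) (simp add: G_def mult.commute[of "norm (g y)"] mult_right_mono)
    moreover have "\<bar>(g (x b) - g y) \<bullet> (g (x t) - g y)\<bar> \<le> \<delta> * \<delta>"
      using gb gt \<delta>_0 by (intro order_trans[OF Cauchy_Schwarz_ineq2] mult_mono) auto
    ultimately show ?thesis unfolding power2_eq_square by linarith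
  qed
  have I: "\<bar>I\<bar> \<le> \<gamma> * W"
    using Cauchy_Schwarz_ineq2[of w "g (x t)"] by (simp add: I_def \<gamma>_def W_def mult.commute)
  have F_y': "F y' \<le> F (x b) - s * P + s\<^sup>2 * \<gamma>\<^sup>2 / 2"
    using descent[of y' "x b"] by (simp add: y' P_def \<gamma>_def power_mult_distrib)
  have z_xs: "(norm (z' - xs))\<^sup>2 = (norm (z - xs))\<^sup>2 - h * (g (x t) \<bullet> (z - xs)) + h\<^sup>2 / 4 * \<gamma>\<^sup>2"
    unfolding z' \<gamma>_def power2_norm_eq_inner
    by (simp add: inner_diff_left inner_diff_right inner_commute algebra_simps power2_eq_square)
  have z_y: "(norm (z' - y'))\<^sup>2 = (p * q)\<^sup>2 * W\<^sup>2 - p * q\<^sup>2 * h * I + q\<^sup>2 * h\<^sup>2 / 4 * \<gamma>\<^sup>2"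
    unfolding w' \<gamma>_def W_def I_def power2_norm_eq_inner
    by (simp add: inner_diff_left inner_diff_right inner_commute algebra_simps power2_eq_square)
  have tangent_xt: "g (x t) \<bullet> (z - xs) \<ge> p * I + F (x t)"
  proof -
    have "z - xs = p *\<^sub>R w + (x t - xs)" by (simp add: xt)
    then have "g (x t) \<bullet> (z - xs) = g (x t) \<bullet> (p *\<^sub>R w) + g (x t) \<bullet> (x t - xs)"
      by (simp only: inner_add_right)
    also have "g (x t) \<bullet> (p *\<^sub>R w) = p * I" by (simp add: I_def inner_commute)
    finally have "g (x t) \<bullet> (z - xs) = p * I + g (x t) \<bullet> (x t - xs)" .
    then show ?thesis using tangent[of "x t"] by simp
  qed
  have bs: "b * s = h * (b - t) * (b + t) / (2 * b)"
    unfolding s_def q_def using pos by (simp add: field_simps power2_eq_square)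
  have bs_0: "0 \<le> b * s" unfolding bs using pos t h by simp
  have bs_le: "b * s \<le> h\<^sup>2"
  proof -
    have "b * s = (h * (b - t)) * ((b + t) / (2 * b))" by (simp add: bs)
    also have "\<dots> \<le> (h * h) * 1" using pos t h by (intro mult_mono) (auto simp: h_def)
    finally show ?thesis by (simp add: power2_eq_square)
  qed
  \<comment> \<open>To leading order \<open>b * s\<close> is \<open>h * (b - t)\<close>. This
    produces the negative multiple of \<open>G^2\<close> that offsets \<open>h^2 / 2\<close> on
    average.\<close>
  have bs_ge: "b * s \<ge> h * (b - t) - h ^ 3 / (2 * a)"
  proof -
    have "h * (b - t) - b * s = h * (b - t)\<^sup>2 / (2 * b)"
      unfolding bs using pos by (simp add: field_simps power2_eq_square)
    also have "\<dots> \<le> h * h\<^sup>2 / (2 * a)"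
      using pos t h by (intro frac_le mult_mono power_mono) (auto simp: h_def)
    finally show ?thesis by (simp add: power2_eq_square power3_eq_cube)
  qed
  have f2: "- (b * s * P) \<le> - (h * (b - t)) * G\<^sup>2 + h ^ 3 / (2 * a) * G\<^sup>2 + h\<^sup>2 * (2 * G * \<delta> + \<delta>\<^sup>2)"
  proof -
    have "b * s * (G\<^sup>2 - (2 * G * \<delta> + \<delta>\<^sup>2)) \<le> b * s * P"
      using P bs_0 by (intro mult_left_mono)
    moreover have "(h * (b - t) - h ^ 3 / (2 * a)) * G\<^sup>2 \<le> b * s * G\<^sup>2"
      using bs_ge by (intro mult_right_mono) auto
    moreover have "b * s * (2 * G * \<delta> + \<delta>\<^sup>2) \<le> h\<^sup>2 * (2 * G * \<delta> + \<delta>\<^sup>2)"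
      using bs_le nn \<delta>_0 by (intro mult_right_mono) auto
    ultimately show ?thesis by (simp add: algebra_simps)
  qed
  have f3: "b * (s\<^sup>2 * \<gamma>\<^sup>2 / 2) \<le> h ^ 4 / (2 * a) * \<gamma>\<^sup>2"
  proof -
    have "b * (s\<^sup>2 * \<gamma>\<^sup>2 / 2) = (b * s)\<^sup>2 / (2 * b) * \<gamma>\<^sup>2"
      using pos by (simp add: power2_eq_square)
    also have "\<dots> \<le> (h\<^sup>2)\<^sup>2 / (2 * a) * \<gamma>\<^sup>2"
      using pos t bs_le bs_0 by (intro mult_right_mono frac_le power_mono) auto
    finally show ?thesis by simp
  qed
  \<comment> \<open>The jump yields \<open>3/2 * h * F (x t)\<close>, of which only
    \<open>h * F (x t)\<close> is needed for the claim; the remaining half is dissipation.\<close>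
  have f4: "h * \<gamma>\<^sup>2 / 4 \<le> 1 / 2 * h * F (x t)"
    using mult_left_mono[OF norm_gradient_le[of "x t"] h] by (simp add: \<gamma>_def)
  \<comment> \<open>The jump contributes \<open>I\<close> with coefficient
    \<open>3/2 + q^2 / 2\<close> instead of 2 (times \<open>- h * p\<close>); this is the
    discrepancy.\<close>
  have f5: "1 / 2 * h * p * (1 - q\<^sup>2) * I \<le> 2 * h\<^sup>2 / a * (\<gamma> * W)"
  proof -
    have "1 - t / b \<le> h / a"
    proof -
      have "1 - t / b = (b - t) / b" using pos by (simp add: field_simps)
      also have "\<dots> \<le> h / a" using pos t by (intro frac_le) (auto simp: h_def)
      finally show ?thesis .
    qed
    moreover have "1 - q \<le> 2 * (1 - t / b)"
      using zero_le_power2[of "1 - t / b"] by (simp add: q_def power_divide power2_eq_square algebra_simps)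
    moreover have "1 - q\<^sup>2 \<le> 2 * (1 - q)"
      using zero_le_power2[of "1 - q"] by (simp add: power2_eq_square algebra_simps)
    ultimately have "1 - q\<^sup>2 \<le> 2 * (2 * (h / a))"
      by (meson mult_left_mono order_trans zero_le_numeral)
    then have q2: "1 - q\<^sup>2 \<le> 4 * (h / a)" by simp
    have q2': "0 \<le> 1 - q\<^sup>2" using q by (simp add: power_le_one)
    have "1 / 2 * h * p * (1 - q\<^sup>2) * I \<le> 1 / 2 * h * p * (1 - q\<^sup>2) * (\<gamma> * W)"
      using I h p q2' by (intro mult_left_mono) auto
    also have "\<dots> \<le> 1 / 2 * h * 1 * (4 * (h / a)) * (\<gamma> * W)"
      using nn h p q2 q2' pos by (intro mult_right_mono mult_mono) auto
    finally show ?thesis by (simp add: power2_eq_square)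
  qed
  \<comment> \<open>The squares of the jump in both norms of the energy; replacing
    \<open>\<gamma>\<close> by \<open>G\<close> exposes the leading error
    \<open>h^2 / 2 * G^2\<close>.\<close>
  have f6: "(3 / 8 + q\<^sup>2 / 8) * h\<^sup>2 * \<gamma>\<^sup>2 \<le> h\<^sup>2 / 2 * G\<^sup>2 + h\<^sup>2 / 2 * (2 * G * \<delta> + \<delta>\<^sup>2)"
  proof -
    have "(3 / 8 + q\<^sup>2 / 8) * h\<^sup>2 * \<gamma>\<^sup>2 \<le> 1 / 2 * h\<^sup>2 * (G + \<delta>)\<^sup>2"
      using q h G\<gamma> nn power_le_one[OF q, of 2] by (intro mult_mono power_mono mult_right_mono) auto
    then show ?thesis by (simp add: power2_eq_square algebra_simps)
  qed
  \<comment> \<open>Dissipation from the contraction of \<open>z - x\<close>. In terms of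
    \<open>v = h / a\<close> it reduces to \<open>1 <= (1 - 2 v) (1 + v)^4\<close>, shown by
    truncating the power at second order.\<close>
  have f7: "h / a * W\<^sup>2 \<le> 1 / 2 * (1 - (p * q)\<^sup>2) * W\<^sup>2"
  proof (rule mult_right_mono)
    define v where "v = h / a"
    have v: "0 \<le> v" "v \<le> 1 / 8" using h ha pos by (simp_all add: v_def field_simps)
    have b: "b = a * (1 + v)" using pos by (simp add: v_def h_def field_simps)
    have "p * q = 1 / (1 + v)\<^sup>2" unfolding pq b using pos by (simp add: power_mult_distrib)
    then have "(p * q)\<^sup>2 = 1 / (1 + v) ^ 4" by (simp add: power_divide)
    moreover have "1 \<le> (1 - 2 * v) * (1 + v) ^ 4"
    proof -
      have "v * v * (2 + 12 * v) \<le> v * (1 / 8) * (2 + 12 * (1 / 8))"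
        using v by (intro mult_mono) auto
      then have "1 \<le> (1 - 2 * v) * (1 + 4 * v + 6 * v\<^sup>2)"
        using v by (simp add: algebra_simps power2_eq_square)
      also have "\<dots> \<le> (1 - 2 * v) * (1 + v) ^ 4"
      proof (rule mult_left_mono)
        have "0 \<le> 4 * (v * (v * v)) + v * (v * (v * v))" using v by simp
        then show "1 + 4 * v + 6 * v\<^sup>2 \<le> (1 + v) ^ 4"
          by (simp add: power2_eq_square power4_eq_xxxx algebra_simps)
      qed (use v in simp)
      finally show ?thesis .
    qed
    then have "1 / (1 + v) ^ 4 \<le> 1 - 2 * v"
      using v by (simp add: divide_le_eq zero_less_power)
    ultimately show "h / a \<le> 1 / 2 * (1 - (p * q)\<^sup>2)" by (simp add: v_def)
  qed simp
  \<comment> \<open>The factor \<open>3/2\<close> collects 1 from \<open>f2\<close> and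
    \<open>1/2\<close> from \<open>f6\<close>.\<close>
  have budget: "h ^ 3 / (2 * a) * G\<^sup>2 + 3 / 2 * h\<^sup>2 * (2 * G * \<delta> + \<delta>\<^sup>2) + h ^ 4 / (2 * a) * \<gamma>\<^sup>2
    + 2 * h\<^sup>2 / a * (\<gamma> * W) \<le> h * \<gamma>\<^sup>2 / 4 + h / a * W\<^sup>2"
    using error_budget[OF r(1) h _ nn(3,1,2) _ G\<gamma>(1)] ab by (simp add: r(2) \<delta>_def h_def)
  have "energy b (step a b t (y, z))
      = b * F y' + 3 / 2 * (norm (z' - xs))\<^sup>2 + 1 / 2 * (norm (z' - y'))\<^sup>2"
    by (simp add: energy_def step_def y'_def z'_def x_def)
  also have "\<dots> \<le> b * F (x b) - b * s * P + b * (s\<^sup>2 * \<gamma>\<^sup>2 / 2)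
      + 3 / 2 * ((norm (z - xs))\<^sup>2 - h * (p * I + F (x t)) + h\<^sup>2 / 4 * \<gamma>\<^sup>2)
      + 1 / 2 * ((p * q)\<^sup>2 * W\<^sup>2 - p * q\<^sup>2 * h * I + q\<^sup>2 * h\<^sup>2 / 4 * \<gamma>\<^sup>2)"
    using mult_left_mono[OF F_y', of b] pos mult_left_mono[OF tangent_xt h]
    unfolding z_xs z_y by (simp add: algebra_simps)
  also have "\<dots> \<le> a * F y + 3 / 2 * (norm (z - xs))\<^sup>2 + 1 / 2 * W\<^sup>2 + (b * F (x b) - a * F y)
      - h * (F (x t) + 2 * p * I) + G\<^sup>2 * (h\<^sup>2 / 2 - h * (b - t))"
    using f2 f3 f4 f5 f6 f7 budget
    by (simp add: algebra_simps add_divide_distrib diff_divide_distrib)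
  finally show ?thesis
    by (simp add: energy_def h_def p_def I_def G_def W_def w_def)
qed

text \<open>The pointwise bound has an explicit primitive in \<open>t\<close>, whose increment is
  exactly the old energy times the interval length.\<close>

lemma energy_step_average:
  fixes r a b :: real
  assumes r: "r \<ge> 1" "a = r ^ 4" and ab: "8 * (b - a) \<le> r" "a \<le> b"
  shows "(\<integral>\<^sup>+t. ennreal (energy b (step a b t p)) * indicator {a<..<b} t \<partial>lborel) \<le> ennreal ((b - a) * energy a p)"
proof -
  obtain y z where p: "p = (y, z)" by (cases p)
  define w where "w = z - y"
  define x where "x = (\<lambda>s. flow a s y z)"
  define h where "h = b - a"
  define c where "c = energy a p + (b * F (x b) - a * F y)"
  define \<psi> where "\<psi> = (\<lambda>t. c - h * (F (x t) + 2 * (a\<^sup>2 / t\<^sup>2) * (w \<bullet> g (x t)))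
    + (norm (g y))\<^sup>2 * (h\<^sup>2 / 2 - h * (b - t)))"
  \<comment> \<open>The bracket in \<open>\<psi>\<close> is the derivative of
    \<open>t * F (x t)\<close>, and the factor of the squared gradient norm takes equal values at
    \<open>a\<close> and \<open>b\<close>.\<close>
  define \<Psi> where "\<Psi> = (\<lambda>t. c * t - h * (t * F (x t))
    + (norm (g y))\<^sup>2 * (h\<^sup>2 / 2 * t + h * (b - t)\<^sup>2 / 2))"
  have a: "a > 0" using r by simp
  have bound: "energy b (step a b t p) \<le> \<psi> t" if "t \<in> {a..b}" for t
    using energy_step[OF r ab(1), of t y z] that by (simp add: \<psi>_def c_def h_def p x_def w_def)
  have \<psi>_0: "\<psi> t \<ge> 0" if "t \<in> {a..b}" for t
    using bound[OF that] energy_nonneg[of b "step a b t p"] a ab by linarith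
  have "(\<psi> has_integral \<Psi> b - \<Psi> a) {a..b}"
  proof (rule fundamental_theorem_of_calculus[OF ab(2)])
    fix t assume "t \<in> {a..b}"
    then have t: "t > 0" using a by simp
    have "(x has_vector_derivative (2 * a\<^sup>2 / t ^ 3) *\<^sub>R w) (at t within {a..b})"
      unfolding x_def flow_def w_def[symmetric] using t
      by (auto intro!: derivative_eq_intros simp: field_simps eval_nat_numeral)
    then have "((\<lambda>t. F (x t)) has_real_derivative ((2 * a\<^sup>2 / t ^ 3) *\<^sub>R w \<bullet> g (x t))) (at t within {a..b})"
      by (rule GDERIV_curve[OF GDERIV])
    then have "(\<Psi> has_real_derivative \<psi> t) (at t within {a..b})"
      unfolding \<Psi>_def \<psi>_def using t
      by (auto intro!: derivative_eq_intros simp: field_simps eval_nat_numeral)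
    then show "(\<Psi> has_vector_derivative \<psi> t) (at t within {a..b})"
      by (simp add: has_real_derivative_iff_has_vector_derivative)
  qed
  moreover have "\<Psi> b - \<Psi> a = h * energy a p"
  proof -
    have "x a = y" using a by (simp add: x_def flow_def)
    then show ?thesis
      by (simp add: \<Psi>_def c_def h_def algebra_simps power2_eq_square add_divide_distrib diff_divide_distrib)
  qed
  ultimately have "(\<integral>\<^sup>+t. ennreal (indicator {a..b} t * \<psi> t) \<partial>lborel) = ennreal (h * energy a p)"
    by (intro nn_integral_has_integral_lebesgue[OF \<psi>_0]) auto
  moreover have "(\<integral>\<^sup>+t. ennreal (energy b (step a b t p)) * indicator {a<..<b} t \<partial>lborel)
      \<le> (\<integral>\<^sup>+t. ennreal (indicator {a..b} t * \<psi> t) \<partial>lborel)"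
    using bound by (intro nn_integral_mono) (auto simp: indicator_def intro!: ennreal_leI)
  ultimately show ?thesis by (simp add: h_def)
qed

text \<open>The energy is controlled at left endpoints, whereas the iterates are positions at the
  jump times. The short displacement costs the factor \<open>5/4\<close>.\<close>

lemma F_flow_le:
  fixes r a b :: real
  assumes r: "r \<ge> 1" "a = r ^ 4" and ab: "8 * (b - a) \<le> r" and t: "a \<le> t" "t \<le> b"
  shows "F (flow a t y z) \<le> 5 / 4 * (energy a (y, z) / a)"
proof -
  define x where "x = flow a t y z"
  define d where "d = norm (x - y)"
  define W where "W = norm (z - y)"
  have a: "a > 0" using r by simp
  have "d \<le> 2 * (b - a) / a * W"
    unfolding d_def x_def W_def using a t by (intro norm_flow_diff) auto
  also have "\<dots> \<le> r / 4 / a * W"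
    using ab a by (intro mult_right_mono divide_right_mono) (auto simp: W_def)
  finally have "d\<^sup>2 \<le> (r / 4 / a * W)\<^sup>2"
    by (intro power_mono) (auto simp: d_def)
  also have "\<dots> = (r\<^sup>2 / a) * (1 / 16 * (W\<^sup>2 / a))"
    by (simp add: power2_eq_square ac_simps)
  also have "\<dots> \<le> 1 * (1 / 16 * (W\<^sup>2 / a))"
    using a r by (intro mult_right_mono) (auto simp: divide_le_eq intro: power_increasing)
  finally have d: "d\<^sup>2 \<le> 1 / 16 * (W\<^sup>2 / a)" by simp
  have "g y \<bullet> (x - y) \<le> norm (g y) * d"
    unfolding d_def by (rule norm_cauchy_schwarz)
  \<comment> \<open>Young's inequality, weighted so that the gradient term costs at most
    \<open>F y / 4\<close>.\<close>
  also have "\<dots> \<le> 1 / 8 * (norm (g y))\<^sup>2 + 2 * d\<^sup>2"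
    using zero_le_power2[of "norm (g y) - 4 * d"] by (simp add: power2_eq_square algebra_simps)
  also have "\<dots> \<le> 1 / 4 * F y + 2 * d\<^sup>2"
    using norm_gradient_le[of y] by simp
  finally have "F x \<le> 5 / 4 * F y + 5 / 2 * d\<^sup>2"
    using descent[of x y] by (simp add: d_def)
  also have "\<dots> \<le> 5 / 4 * (F y + 1 / 2 * (W\<^sup>2 / a))"
  proof -
    have "0 \<le> W\<^sup>2 / a" using a by simp
    then have "5 / 2 * d\<^sup>2 \<le> 5 / 8 * (W\<^sup>2 / a)" using d by linarith
    then show ?thesis by simp
  qed
  also have "F y + 1 / 2 * (W\<^sup>2 / a) \<le> energy a (y, z) / a"
    using a by (simp add: energy_def W_def field_simps)
  finally show ?thesis by (simp add: x_def)
qed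

section \<open>Random times\<close>

lemma continuous_on_F: "continuous_on S F"
  using GDERIV unfolding gderiv_def
  by (meson continuous_at_imp_continuous_on has_derivative_continuous)

lemma continuous_on_g: "continuous_on S g"
  by (rule lipschitz_on_continuous_on[of 1]) (simp add: lipschitz_on_def dist_norm lipschitz)

lemma measurable_F [measurable]: "F \<in> borel_measurable borel"
  by (rule borel_measurable_continuous_onI[OF continuous_on_F])

lemma measurable_g [measurable]: "g \<in> borel_measurable borel"
  by (rule borel_measurable_continuous_onI[OF continuous_on_g])

lemma measurable_step [measurable (raw)]:
  assumes [measurable]: "t \<in> borel_measurable N" "p \<in> borel_measurable N"
  shows "(\<lambda>\<omega>. step a b (t \<omega>) (p \<omega>)) \<in> borel_measurable N"
proof -
  define y z where "y = (\<lambda>\<omega>. fst (p \<omega>))" and "z = (\<lambda>\<omega>. snd (p \<omega>))"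
  have [measurable]: "y \<in> borel_measurable N" "z \<in> borel_measurable N"
    unfolding y_def z_def
    by (rule measurable_compose[OF assms(2) borel_measurable_continuous_onI], intro continuous_intros)+
  show ?thesis
    unfolding step_def jump_def flow_def case_prod_unfold y_def[symmetric] z_def[symmetric]
      fun_cong[OF y_def, symmetric] fun_cong[OF z_def, symmetric] by measurable
qed

lemma measurable_energy [measurable]: "energy t \<in> borel_measurable borel"
proof -
  have "continuous_on UNIV (energy t)"
    unfolding energy_def case_prod_unfold
    by (intro continuous_intros continuous_on_compose2[OF continuous_on_F, of UNIV]) auto
  then show ?thesis by (rule borel_measurable_continuous_onI)
qed

text \<open>The pair at time \<open>A k\<close>. It depends only on the times with index below
  \<open>k\<close>, hence is independent of \<open>u k\<close>.\<close>

primrec state :: "'a \<Rightarrow> (nat \<Rightarrow> real) \<Rightarrow> nat \<Rightarrow> 'a \<times> 'a" where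
  "state x0 u 0 = (x0, x0)"
| "state x0 u (Suc k) = step (A k) (A (Suc k)) (u k) (state x0 u k)"

lemma state_cong: "(\<And>j. j < k \<Longrightarrow> u j = v j) \<Longrightarrow> state x0 u k = state x0 v k"
  by (induction k) auto

text \<open>Only coordinates below \<open>k\<close> are required to be measurable, so that the
  product space over \<open>{..<k}\<close> is covered.\<close>

lemma measurable_state:
  assumes "\<And>j. j < k \<Longrightarrow> (\<lambda>\<omega>. u \<omega> j) \<in> borel_measurable N"
  shows "(\<lambda>\<omega>. state x0 (u \<omega>) k) \<in> borel_measurable N"
  using assms
proof (induction k)
  case (Suc k)
  then have [measurable]: "(\<lambda>\<omega>. state x0 (u \<omega>) k) \<in> borel_measurable N"
    "(\<lambda>\<omega>. u \<omega> k) \<in> borel_measurable N" by auto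
  show ?case by simp
qed simp

end

text \<open>With \<open>r\<close> the cube root of \<open>1 + k / 12\<close>, consecutive cubes
  differ by \<open>1/12\<close>, so \<open>r\<close> grows by at most \<open>1 / (36 r^2)\<close>
  and \<open>r^4\<close> by about \<open>r / 9\<close>, which is below \<open>r / 8\<close>.\<close>

lemma A_growth: "\<exists>r\<ge>1. A k = r ^ 4 \<and> 8 * (A (Suc k) - A k) \<le> r \<and> A k < A (Suc k)"
proof (intro exI conjI)
  define r where "r = (1 + real k / 12) powr (1 / 3)"
  define r' where "r' = (1 + real (Suc k) / 12) powr (1 / 3)"
  have root: "(x powr (1 / 3)) ^ 4 = x powr (4 / 3)" "(x powr (1 / 3)) ^ 3 = x" if "x > 0" for x :: real
    using that by (simp_all add: powr_power)
  have A: "A k = r ^ 4" "A (Suc k) = r' ^ 4"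
    unfolding A_def r_def r'_def by (subst root; simp add: add_pos_nonneg)+
  have cube: "r ^ 3 = 1 + real k / 12" "r' ^ 3 = 1 + real (Suc k) / 12"
    unfolding r_def r'_def by (subst root; simp add: add_pos_nonneg)+
  show r: "1 \<le> r" by (simp add: r_def ge_one_powr_ge_zero)
  have r': "r < r'" by (simp add: r_def r'_def powr_less_mono2)
  show "A k = r ^ 4" by (rule A)
  show "A k < A (Suc k)" unfolding A using r r' by (intro power_strict_mono) auto
  have d: "r' ^ 3 - r ^ 3 = 1 / 12" by (simp add: cube field_simps)
  have "(r' - r) * (3 * r\<^sup>2) \<le> (r' - r) * (r'\<^sup>2 + r' * r + r\<^sup>2)"
  proof (rule mult_left_mono)
    have "r\<^sup>2 \<le> r'\<^sup>2" "r * r \<le> r' * r" using r r' by (auto intro!: power_mono mult_right_mono)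
    then show "3 * r\<^sup>2 \<le> r'\<^sup>2 + r' * r + r\<^sup>2" by (simp add: power2_eq_square)
  qed (use r' in simp)
  also have "\<dots> = 1 / 12"
    unfolding d[symmetric] by (simp add: power2_eq_square power3_eq_cube algebra_simps)
  finally have e: "(r' - r) * r\<^sup>2 \<le> 1 / 36" by simp
  have "(r' - r) * 1 \<le> (r' - r) * r\<^sup>2" using r r' by (intro mult_left_mono) auto
  with e r have r'_le: "r' \<le> 37 / 36 * r" by simp
  define E where "E = (r' - r) * r\<^sup>2 * r"
  have E: "E \<le> 1 / 36 * r"
    unfolding E_def using r by (intro mult_right_mono[OF e]) simp
  \<comment> \<open>One factor is split off the fourth powers to use the known difference of the
    cubes.\<close>
  have "A (Suc k) - A k = r' * (r' ^ 3 - r ^ 3) + E"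
    unfolding A E_def by (simp add: power2_eq_square power3_eq_cube power4_eq_xxxx algebra_simps)
  also have "\<dots> = r' / 12 + E" unfolding d by simp
  finally have "8 * (A (Suc k) - A k) = 8 * (r' / 12 + E)" by (simp only:)
  also have "\<dots> \<le> r" using r r'_le E by simp
  finally show "8 * (A (Suc k) - A k) \<le> r" .
qed

lemma A_pos: "A k > 0"
  by (simp add: A_def)

context smooth_convex begin

text \<open>Induction: by independence and Fubini, \<open>u k\<close> is integrated with the earlier
  times fixed, and the averaged step does not increase the energy.\<close>

lemma expected_energy:
  fixes u :: "nat \<Rightarrow> 'm \<Rightarrow> real"
  assumes "prob_space M" and indep: "prob_space.indep_vars M (\<lambda>_. borel) u UNIV"
    and unif: "\<And>k. distr M borel (u k) = uniform_measure lborel {A k<..<A (Suc k)}"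
  shows "(\<integral>\<^sup>+\<omega>. ennreal (energy (A k) (state x0 (\<lambda>j. u j \<omega>) k)) \<partial>M) \<le> ennreal (2 * (norm (x0 - xs))\<^sup>2)"
proof (induction k)
  interpret prob_space M by fact
  case 0
  \<comment> \<open>\<open>A 0 = 1\<close> and both components are \<open>x0\<close>, so the
    constant is \<open>1/2 + 3/2\<close>.\<close>
  have "energy (A 0) (state x0 v 0) \<le> 2 * (norm (x0 - xs))\<^sup>2" for v
    using F_le[of x0] by (simp add: energy_def A_def)
  then show ?case
    using nn_integral_mono[of M "\<lambda>\<omega>. ennreal (energy (A 0) (state x0 (\<lambda>j. u j \<omega>) 0))" "\<lambda>_. ennreal (2 * (norm (x0 - xs))\<^sup>2)"]
    by (simp add: ennreal_leI emeasure_space_1)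
next
  interpret prob_space M by fact
  case (Suc k)
  let ?P = "\<lambda>I. PiM I (\<lambda>_::nat. borel :: real measure)" and ?R = "\<lambda>I \<omega>. restrict (\<lambda>i. u i \<omega>) I"
  let ?e = "\<lambda>t p. ennreal (energy (A (Suc k)) (step (A k) (A (Suc k)) t p))"
  obtain r where r: "r \<ge> 1" "A k = r ^ 4" "8 * (A (Suc k) - A k) \<le> r" "A k < A (Suc k)"
    using A_growth by blast
  have u [measurable]: "u j \<in> borel_measurable M" for j
    using indep unfolding indep_vars_def by simp
  have "indep_var (?P {..<k}) (?R {..<k}) (?P {k}) (?R {k})"
    by (rule indep_var_restrict[OF indep]) auto
  then have distr: "distr M (?P {..<k} \<Otimes>\<^sub>M ?P {k}) (\<lambda>\<omega>. (?R {..<k} \<omega>, ?R {k} \<omega>))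
      = distr M (?P {..<k}) (?R {..<k}) \<Otimes>\<^sub>M distr M (?P {k}) (?R {k})"
    by (simp add: indep_var_distribution_eq)
  have state_R: "state x0 (?R {..<k} \<omega>) k = state x0 (\<lambda>j. u j \<omega>) k" for \<omega>
    by (rule state_cong) simp
  have [measurable]: "(\<lambda>v. state x0 v k) \<in> borel_measurable (?P {..<k})"
    by (rule measurable_state) simp
  interpret D: prob_space "distr M (?P {k}) (?R {k})"
    by (rule prob_space_distr) simp
  have "(\<integral>\<^sup>+\<omega>. ennreal (energy (A (Suc k)) (state x0 (\<lambda>j. u j \<omega>) (Suc k))) \<partial>M)
      = (\<integral>\<^sup>+q. ?e (snd q k) (state x0 (fst q) k)
          \<partial>distr M (?P {..<k} \<Otimes>\<^sub>M ?P {k}) (\<lambda>\<omega>. (?R {..<k} \<omega>, ?R {k} \<omega>)))"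
    by (subst nn_integral_distr) (simp_all add: state_R)
  also have "\<dots> = (\<integral>\<^sup>+v. \<integral>\<^sup>+v'. ?e (v' k) (state x0 v k) \<partial>distr M (?P {k}) (?R {k})
      \<partial>distr M (?P {..<k}) (?R {..<k}))"
    unfolding distr by (subst D.nn_integral_fst[symmetric]) simp_all
  also have "\<dots> \<le> (\<integral>\<^sup>+v. ennreal (energy (A k) (state x0 v k)) \<partial>distr M (?P {..<k}) (?R {..<k}))"
  proof (rule nn_integral_mono)
    fix v
    let ?h = "A (Suc k) - A k" and ?p = "state x0 v k"
    have "(\<integral>\<^sup>+v'. ?e (v' k) ?p \<partial>distr M (?P {k}) (?R {k})) = (\<integral>\<^sup>+t. ?e t ?p \<partial>distr M borel (u k))"
      by (simp add: nn_integral_distr)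
    also have "\<dots> = (\<integral>\<^sup>+t. ?e t ?p * indicator {A k<..<A (Suc k)} t \<partial>lborel) / ennreal ?h"
      using r(4) unfolding unif by (subst nn_integral_uniform_measure) simp_all
    also have "\<dots> \<le> ennreal (?h * energy (A k) ?p) / ennreal ?h"
      using r by (intro divide_right_mono_ennreal energy_step_average[of r]) auto
    also have "\<dots> = ennreal (energy (A k) ?p)"
      using r(4) by (simp add: divide_ennreal energy_nonneg less_imp_le[OF A_pos])
    finally show "(\<integral>\<^sup>+v'. ?e (v' k) ?p \<partial>distr M (?P {k}) (?R {k})) \<le> ennreal (energy (A k) ?p)" .
  qed
  also have "\<dots> = (\<integral>\<^sup>+\<omega>. ennreal (energy (A k) (state x0 (\<lambda>j. u j \<omega>) k)) \<partial>M)"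
    by (subst nn_integral_distr) (simp_all add: state_R)
  finally show ?case using Suc by (rule order_trans)
qed

end

section \<open>The heavy-ball method\<close>

lemma flow_flow: "s \<noteq> 0 \<Longrightarrow> flow s t (flow r s x z) z = flow r t x z"
  by (simp add: flow_def)

locale heavy_ball_method =
  fixes L :: real and f :: "real ^ 'd \<Rightarrow> real" and xstar :: "real ^ 'd"
  assumes L: "L > 0" and convex_f: "convex_on UNIV f" and smooth: "smooth_with L f"
    and min: "\<And>y. f xstar \<le> f y"

sublocale heavy_ball_method \<subseteq> smooth_convex "\<lambda>x. (f x - f xstar) / L" "\<lambda>x. gradient f x /\<^sub>R L" xstar
proof
  fix x y :: "real ^ 'd"
  have "GDERIV f x :> gradient f x"
    using smooth by (intro GDERIV_gradient) (simp add: smooth_with_def)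
  then show "GDERIV (\<lambda>x. (f x - f xstar) / L) x :> gradient f x /\<^sub>R L"
    unfolding gderiv_def using L
    by (auto intro!: derivative_eq_intros simp: inner_scaleR_right divide_inverse mult.commute)
  show "norm (gradient f x /\<^sub>R L - gradient f y /\<^sub>R L) \<le> norm (x - y)"
  proof -
    have "norm (gradient f x /\<^sub>R L - gradient f y /\<^sub>R L) = norm (gradient f x - gradient f y) / L"
      using L by (simp add: scaleR_diff_right[symmetric] divide_inverse mult.commute)
    also have "\<dots> \<le> norm (x - y)"
      using smooth L by (simp add: smooth_with_def divide_le_eq mult.commute)
    finally show ?thesis .
  qed
  show "0 \<le> (f x - f xstar) / L" using L min by simp
next
  have "convex_on UNIV (\<lambda>x. (1 / L) * (f x + - f xstar))"
    using L convex_f by (intro convex_on_cmul convex_on_add) (auto simp: convex_on_const)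
  then show "convex_on UNIV (\<lambda>x. (f x - f xstar) / L)" by simp
qed simp

context heavy_ball_method begin

lemma delta_pos:
  assumes "\<And>j. A j < u j \<and> u j < A (Suc j)"
  shows "delta u k > 0"
proof -
  have "0 < u k" using assms[of k] A_pos[of k] by linarith
  moreover have "u k < u (Suc k)" using assms[of k] assms[of "Suc k"] by linarith
  ultimately have "1 / (u (Suc k))\<^sup>2 < 1 / (u k)\<^sup>2"
    by (intro divide_strict_left_mono) (auto intro!: power_strict_mono)
  then show ?thesis by (simp add: delta_def)
qed

text \<open>The variable \<open>z\<close> is eliminated: each displacement is a multiple of
  \<open>z (Suc k) - X k\<close>, and conservation along the flow expresses \<open>z k - X k\<close>
  by the previous displacement.\<close>

lemma heavy_ball_eq_flow:
  assumes u: "\<And>j. A j < u j \<and> u j < A (Suc j)"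
  shows "heavy_ball L f u x0 k = flow (A k) (u k) (fst (state x0 u k)) (snd (state x0 u k))"
proof -
  define z where "z = (\<lambda>k. snd (state x0 u k))"
  define X where "X = (\<lambda>k. flow (A k) (u k) (fst (state x0 u k)) (z k))"
  have u_pos: "u k > 0" for k using u[of k] A_pos[of k] by linarith
  have z_Suc: "z (Suc k) = z k - ((A (Suc k) - A k) / 2) *\<^sub>R (gradient f (X k) /\<^sub>R L)" for k
    by (simp add: z_def X_def step_def jump_def case_prod_unfold)
  have fst_Suc: "fst (state x0 u (Suc k)) = flow (u k) (A (Suc k)) (X k) (z (Suc k))" for k
    by (simp add: z_def X_def step_def case_prod_unfold)
  have X_Suc: "X (Suc k) = flow (u k) (u (Suc k)) (X k) (z (Suc k))" for k
    unfolding X_def[THEN fun_cong, of "Suc k"] fst_Suc using A_pos[of "Suc k"] by (simp add: flow_flow)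
  have diff: "X (Suc k) - X k = (2 * delta u k * (u k)\<^sup>2) *\<^sub>R (z (Suc k) - X k)" for k
  proof -
    have *: "2 * delta u k * (u k)\<^sup>2 = 1 - (u k)\<^sup>2 / (u (Suc k))\<^sup>2"
      using u_pos[of k] by (simp add: delta_def field_simps)
    show ?thesis unfolding X_Suc flow_def * by (simp add: algebra_simps)
  qed
  \<comment> \<open>\<open>t\<^sup>2 (z - x)\<close> is conserved by the flow.\<close>
  have momentum: "(2 * delta u k * (u k)\<^sup>2) *\<^sub>R (z k - X k) = beta u k *\<^sub>R (X k - X (k - 1))" for k
  proof (cases k)
    \<comment> \<open>Both sides vanish: \<open>beta u 0 = 0\<close>, and the two components start
      equal.\<close>
    case 0
    then show ?thesis by (simp add: beta_def X_def z_def flow_def)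
  next
    case (Suc j)
    have 1: "(u k)\<^sup>2 *\<^sub>R (z k - X k) = (u j)\<^sup>2 *\<^sub>R (z k - X j)"
      unfolding Suc X_Suc flow_def using u_pos[of "Suc j"] by simp
    have 2: "X k - X j = (2 * delta u j * (u j)\<^sup>2) *\<^sub>R (z k - X j)"
      unfolding Suc by (rule diff)
    have "(2 * delta u k * (u k)\<^sup>2) *\<^sub>R (z k - X k) = (2 * delta u k) *\<^sub>R ((u k)\<^sup>2 *\<^sub>R (z k - X k))"
      by simp
    also have "\<dots> = (delta u k / delta u j) *\<^sub>R (X k - X j)"
      unfolding 1 2 using delta_pos[OF u, of j] by simp
    finally show ?thesis by (simp add: beta_def Suc)
  qed
  have X_rec: "X (Suc k) = X k - eta L u k *\<^sub>R gradient f (X k) + beta u k *\<^sub>R (X k - X (k - 1))" for k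
  proof -
    let ?c = "2 * delta u k * (u k)\<^sup>2"
    have "eta L u k = ?c * ((A (Suc k) - A k) / 2) * inverse L"
      using L by (simp add: eta_def field_simps)
    then have "?c *\<^sub>R (((A (Suc k) - A k) / 2) *\<^sub>R (gradient f (X k) /\<^sub>R L)) = eta L u k *\<^sub>R gradient f (X k)"
      by (simp only: scaleR_scaleR mult.assoc)
    moreover have "X (Suc k) - X k = ?c *\<^sub>R (z k - X k)
        - ?c *\<^sub>R (((A (Suc k) - A k) / 2) *\<^sub>R (gradient f (X k) /\<^sub>R L))"
      unfolding diff z_Suc scaleR_diff_right by simp
    ultimately have "X (Suc k) - X k = beta u k *\<^sub>R (X k - X (k - 1)) - eta L u k *\<^sub>R gradient f (X k)"
      by (simp only: momentum)
    then have "X (Suc k) = beta u k *\<^sub>R (X k - X (k - 1)) - eta L u k *\<^sub>R gradient f (X k) + X k"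
      by (simp only: diff_eq_eq)
    then show ?thesis by (simp only: add_diff_eq diff_add_eq add.commute)
  qed
  have "heavy_ball L f u x0 k = X k" for k
  proof (induction k rule: less_induct)
    case (less k)
    show ?case
    proof (cases k)
      case 0
      then show ?thesis by (simp add: X_def z_def flow_def)
    next
      case (Suc j)
      then show ?thesis using less[of j] less[of "j - 1"] X_rec[of j] by simp
    qed
  qed
  then show ?thesis by (simp add: X_def z_def)
qed

section \<open>Measurability of the iterates\<close>

lemma measurable_gradient: "gradient f \<in> borel_measurable borel"
proof -
  have "(\<lambda>x. L *\<^sub>R (gradient f x /\<^sub>R L)) \<in> borel_measurable borel"
    using measurable_g by (rule borel_measurable_scaleR[OF borel_measurable_const])
  then show ?thesis using L by simp
qed

lemma measurable_f: "f \<in> borel_measurable borel"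
proof -
  have "(\<lambda>x. L * ((f x - f xstar) / L) + f xstar) \<in> borel_measurable borel"
    using measurable_F by (intro borel_measurable_add borel_measurable_times) auto
  then show ?thesis using L by simp
qed

text \<open>The recursion is used directly, since the description by the flow is available only for
  times inside their intervals, that is, almost surely.\<close>

lemma measurable_heavy_ball:
  assumes [measurable]: "\<And>j. u j \<in> borel_measurable N"
  shows "(\<lambda>\<omega>. heavy_ball L f (\<lambda>j. u j \<omega>) x0 k) \<in> borel_measurable N"
proof (induction k rule: less_induct)
  case (less k)
  show ?case
  proof (cases k)
    case 0
    then show ?thesis by simp
  next
    case (Suc j)
    have [measurable]: "(\<lambda>\<omega>. heavy_ball L f (\<lambda>j. u j \<omega>) x0 j) \<in> borel_measurable N"
      "(\<lambda>\<omega>. heavy_ball L f (\<lambda>j. u j \<omega>) x0 (j - 1)) \<in> borel_measurable N"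
      using Suc less by simp_all
    note measurable_gradient [measurable]
    have [measurable]: "(\<lambda>\<omega>. eta L (\<lambda>j. u j \<omega>) j) \<in> borel_measurable N"
      "(\<lambda>\<omega>. beta (\<lambda>j. u j \<omega>) j) \<in> borel_measurable N"
      unfolding eta_def beta_def delta_def by measurable
    show ?thesis unfolding Suc heavy_ball.simps by measurable
  qed
qed

end

text \<open>Integrability is part of the claim because the integral of a non-integrable function is
  0 by convention, which would make the bound vacuous.\<close>

theorem theorem11:
  fixes L :: real
    and f :: "real ^ 'd \<Rightarrow> real"
    and xstar x0 :: "real ^ 'd"
    and M :: "'m measure"
    and u :: "nat \<Rightarrow> 'm \<Rightarrow> real"
    and K :: nat
  assumes "L > 0"
    and "convex_on UNIV f"
    and "smooth_with L f"
    and "\<forall>y. f xstar \<le> f y"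
    and "prob_space M"
    and "prob_space.indep_vars M (\<lambda>_. borel) u UNIV"
    and "\<forall>k. distr M borel (u k) = uniform_measure lborel {A k<..<A (Suc k)}"
    and "K \<ge> 1"
  shows "(AE \<omega> in M. \<forall>k. delta (\<lambda>j. u j \<omega>) k > 0)
    \<and> integrable M (\<lambda>\<omega>. f (heavy_ball L f (\<lambda>j. u j \<omega>) x0 K) - f xstar)
    \<and> prob_space.expectation M (\<lambda>\<omega>. f (heavy_ball L f (\<lambda>j. u j \<omega>) x0 K) - f xstar)
        \<le> 84 * L * (norm (x0 - xstar))\<^sup>2 / real K powr (4 / 3)"
proof -
  interpret heavy_ball_method L f xstar
    using assms by unfold_locales auto
  interpret prob_space M by fact
  define R where "R = (norm (x0 - xstar))\<^sup>2"
  let ?X = "\<lambda>\<omega>. heavy_ball L f (\<lambda>j. u j \<omega>) x0 K"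
  let ?S = "\<lambda>\<omega>. state x0 (\<lambda>j. u j \<omega>) K"
  have u [measurable]: "u j \<in> borel_measurable M" for j
    using assms(6) unfolding indep_vars_def by simp
  have [measurable]: "?X \<in> borel_measurable M"
    by (rule measurable_heavy_ball) simp
  have [measurable]: "?S \<in> borel_measurable M"
    by (rule measurable_state) simp
  note measurable_f [measurable]
  have "AE \<omega> in M. A j < u j \<omega> \<and> u j \<omega> < A (Suc j)" for j
  proof -
    have "A j < A (Suc j)" using A_growth by blast
    then have "AE t in uniform_measure lborel {A j<..<A (Suc j)}. t \<in> {A j<..<A (Suc j)}"
      by (intro AE_uniform_measureI) auto
    then have "AE t in distr M borel (u j). A j < t \<and> t < A (Suc j)"
      unfolding assms(7)[rule_format] by simp
    then show ?thesis by (subst (asm) AE_distr_iff) auto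
  qed
  then have AE_u: "AE \<omega> in M. \<forall>j. A j < u j \<omega> \<and> u j \<omega> < A (Suc j)"
    by (simp add: AE_all_countable)
  have AE_delta: "AE \<omega> in M. \<forall>k. delta (\<lambda>j. u j \<omega>) k > 0"
    using AE_u by eventually_elim (auto intro!: delta_pos)
  obtain r where r: "r \<ge> 1" "A K = r ^ 4" "8 * (A (Suc K) - A K) \<le> r"
    using A_growth by blast
  \<comment> \<open>\<open>5/4\<close> is the cost of passing from \<open>A K\<close> to
    \<open>u K\<close>, and \<open>L\<close> undoes the scaling of \<open>f\<close>.\<close>
  define c where "c = 5 / 4 * L / A K"
  have c: "c \<ge> 0" using L A_pos[of K] by (simp add: c_def)
  have bound: "AE \<omega> in M. f (?X \<omega>) - f xstar \<le> c * energy (A K) (?S \<omega>)"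
    using AE_u
  proof eventually_elim
    case (elim \<omega>)
    then have "(f (?X \<omega>) - f xstar) / L \<le> 5 / 4 * (energy (A K) (?S \<omega>) / A K)"
      using F_flow_le[OF r, of "u K \<omega>" "fst (?S \<omega>)" "snd (?S \<omega>)"]
      by (subst heavy_ball_eq_flow) (auto simp: less_imp_le)
    then show ?case using L by (simp add: c_def divide_le_eq field_simps)
  qed
  have nn_energy: "(\<integral>\<^sup>+\<omega>. ennreal (energy (A K) (?S \<omega>)) \<partial>M) \<le> ennreal (2 * R)"
    unfolding R_def using assms by (intro expected_energy) auto
  have int_energy: "integrable M (\<lambda>\<omega>. energy (A K) (?S \<omega>))"
    by (rule integrableI_nonneg)
      (use nn_energy in \<open>auto simp: energy_nonneg less_imp_le[OF A_pos] intro: order_le_less_trans\<close>)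
  have exp_energy: "expectation (\<lambda>\<omega>. energy (A K) (?S \<omega>)) \<le> 2 * R"
    using nn_energy
    by (subst (asm) nn_integral_eq_integral[OF int_energy])
      (auto simp: energy_nonneg less_imp_le[OF A_pos] R_def)
  have int: "integrable M (\<lambda>\<omega>. f (?X \<omega>) - f xstar)"
    by (rule Bochner_Integration.integrable_bound[OF integrable_mult_right[OF int_energy, of c]])
      (use bound min in \<open>auto simp: abs_mult energy_nonneg less_imp_le[OF A_pos] c\<close>)
  have "expectation (\<lambda>\<omega>. f (?X \<omega>) - f xstar) \<le> expectation (\<lambda>\<omega>. c * energy (A K) (?S \<omega>))"
    by (intro integral_mono_AE int integrable_mult_right int_energy bound)
  also have "\<dots> \<le> c * (2 * R)"
    using exp_energy c by (simp add: mult_left_mono)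
  also have "\<dots> = 5 / 2 * (L * R) / A K"
    by (simp add: c_def)
  also have "\<dots> \<le> 84 * L * R / real K powr (4 / 3)"
  proof -
    \<comment> \<open>\<open>84 = 5/2 * 168/5\<close>, so this is the numerical fact behind the
      constant; cubing turns it into a comparison with \<open>12^4\<close>.\<close>
    have "(12::real) powr (4 / 3) \<le> 168 / 5"
    proof (rule power_le_imp_le_base[of _ 2])
      show "(12 powr (4 / 3)) ^ Suc 2 \<le> (168 / 5 :: real) ^ Suc 2"
        by (simp add: powr_power power_divide)
    qed simp
    then have "real K powr (4 / 3) \<le> 168 / 5 * (real K / 12) powr (4 / 3)"
      using assms(8) by (simp add: powr_divide field_simps)
    also have "\<dots> \<le> 168 / 5 * A K"
      unfolding A_def by (intro mult_left_mono powr_mono2) auto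
    finally have "5 / 2 * (L * R) / A K \<le> 5 / 2 * (L * R) / (5 / 168 * real K powr (4 / 3))"
      using L assms(8) A_pos[of K] by (intro divide_left_mono) (auto simp: R_def)
    then show ?thesis by simp
  qed
  finally show ?thesis
    using AE_delta int by (simp add: R_def)
qed

end
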